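(* Let $K\ge1$ and let $f=h+\overline{g}$ be a $K$-quasiregular harmonic mapping in $\mathbb{D}$ with $C=\sup_{0<r<1}S_f(r)<\infty$, where $h(z)=\sum_{n=1}^{\infty}a_nz^n$ and $g(z)=\sum_{n=1}^{\infty}b_nz^n$ are analytic in $\mathbb{D}$. Then $f\in\mathcal{HB}$ (i.e. $f$ is a harmonic Bloch mapping), and $$|a_n|+|b_n|\le\begin{cases}\sqrt{CK}&\text{if }n=1,\\[2mm] \dfrac{4\sqrt{CK}}{\pi}\left(1+\dfrac1{n-1}\right)^{n-1}&\text{if }n\ge2.\end{cases}$$ In the special case $C=K=1$ the estimate of $|a_1|$ is sharp, with extremal function $f(z)=z$.
   Context: $\mathbb{D}$ is the open unit disk in $\mathbb{C}$ and $\mathbb{D}_r=\{z:|z|<r\}$. A harmonic mapping in $\mathbb{D}$ is a complex-valued function $f=h+\overline{g}$ with $h,g$ analytic in $\mathbb{D}$; $f_z=h'$, $f_{\overline z}=\overline{g'}$, Jacobian $J_f=|h'|^2-|g'|^2$. It is sense-preserving (and locally univalent) if $|g'|<|h'|$ in $\mathbb{D}$. Put $\Lambda_f=|f_z|+|f_{\overline z}|$ and $\lambda_f=\big||f_z|-|f_{\overline z}|\big|$. A sense-preserving harmonic mapping $f$ in $\mathbb{D}$ is $K$-quasiregular ($K\ge1$) if $\Lambda_f(z)/\lambda_f(z)\le K$, i.e. $|f_{\overline z}(z)|/|f_z(z)|\le\frac{K-1}{K+1}$, for all $z\in\mathbb{D}$. $S_f(r)=\int_{\mathbb{D}_r}J_f\,dA$,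 where $dA$ is the normalized area measure on $\mathbb{D}$ (so $A(\mathbb{D})=1$). A harmonic mapping $f$ in $\mathbb{D}$ is a harmonic Bloch mapping, $f\in\mathcal{HB}$, if $\sup_{z\ne w\in\mathbb{D}}|f(z)-f(w)|/\sigma(z,w)<\infty$, where $\sigma(z,w)=\operatorname{arctanh}\left|\frac{z-w}{1-\overline{z}w}\right|$ is the hyperbolic distance; it is known that this supremum equals $\sup_{z\in\mathbb{D}}(1-|z|^2)\Lambda_f(z)$. *)

theory Defs
  imports "HOL-Complex_Analysis.Complex_Analysis"
begin

abbreviation unit_disk :: "complex set" where
  "unit_disk \<equiv> ball 0 1"

definition harmonic_mapping :: "(complex \<Rightarrow> complex) \<Rightarrow> bool" where
  "harmonic_mapping f \<longleftrightarrow> (\<exists>h g. h holomorphic_on unit_disk \<and> g holomorphic_on unit_disk \<and>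
     (\<forall>z\<in>unit_disk. f z = h z + cnj (g z)))"

text \<open>
  The Wirtinger derivatives \<open>f_z = (f_x - i f_y) / 2\<close> and \<open>f_zbar = (f_x + i f_y) / 2\<close>,
  where \<open>f_x\<close> and \<open>f_y\<close> are the values of the real Frechet derivative at \<open>1\<close> and \<open>\<i>\<close>.
\<close>

definition wirt_z :: "(complex \<Rightarrow> complex) \<Rightarrow> complex \<Rightarrow> complex" where
  "wirt_z f z = (frechet_derivative f (at z) 1 - \<i> * frechet_derivative f (at z) \<i>) / 2"

definition wirt_zbar :: "(complex \<Rightarrow> complex) \<Rightarrow> complex \<Rightarrow> complex" where
  "wirt_zbar f z = (frechet_derivative f (at z) 1 + \<i> * frechet_derivative f (at z) \<i>) / 2"

definition jacobian :: "(complex \<Rightarrow> complex) \<Rightarrow> complex \<Rightarrow> real" where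
  "jacobian f z = (cmod (wirt_z f z))\<^sup>2 - (cmod (wirt_zbar f z))\<^sup>2"

definition Lambda_max :: "(complex \<Rightarrow> complex) \<Rightarrow> complex \<Rightarrow> real" where
  "Lambda_max f z = cmod (wirt_z f z) + cmod (wirt_zbar f z)"

definition lambda_min :: "(complex \<Rightarrow> complex) \<Rightarrow> complex \<Rightarrow> real" where
  "lambda_min f z = \<bar>cmod (wirt_z f z) - cmod (wirt_zbar f z)\<bar>"

definition sense_preserving :: "(complex \<Rightarrow> complex) \<Rightarrow> bool" where
  "sense_preserving f \<longleftrightarrow> (\<forall>z\<in>unit_disk. cmod (wirt_zbar f z) < cmod (wirt_z f z))"

definition quasiregular_harmonic :: "real \<Rightarrow> (complex \<Rightarrow> complex) \<Rightarrow> bool" where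
  "quasiregular_harmonic K f \<longleftrightarrow> 1 \<le> K \<and> harmonic_mapping f \<and> sense_preserving f \<and>
     (\<forall>z\<in>unit_disk. Lambda_max f z / lambda_min f z \<le> K)"

definition area_measure :: "complex measure" where
  "area_measure = uniform_measure lborel unit_disk"

definition area_S :: "(complex \<Rightarrow> complex) \<Rightarrow> real \<Rightarrow> real" where
  "area_S f r = (LINT z : ball 0 r | area_measure. jacobian f z)"

definition hyp_dist :: "complex \<Rightarrow> complex \<Rightarrow> real" where
  "hyp_dist z w = artanh (cmod ((z - w) / (1 - cnj z * w)))"

definition harmonic_Bloch :: "(complex \<Rightarrow> complex) set" where
  "harmonic_Bloch = {f. harmonic_mapping f \<and>
     bdd_above {cmod (f z - f w) / hyp_dist z w | z w. z \<in> unit_disk \<and> w \<in> unit_disk \<and> z \<noteq> w}}"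

text \<open>
  The power series start at exponent \<open>1\<close>, so the values \<open>a 0\<close> and \<open>b 0\<close> are irrelevant.
\<close>

definition harmonic_expansion ::
  "(complex \<Rightarrow> complex) \<Rightarrow> (complex \<Rightarrow> complex) \<Rightarrow> (complex \<Rightarrow> complex) \<Rightarrow>
   (nat \<Rightarrow> complex) \<Rightarrow> (nat \<Rightarrow> complex) \<Rightarrow> bool" where
  "harmonic_expansion f h g a b \<longleftrightarrow>
     h holomorphic_on unit_disk \<and> g holomorphic_on unit_disk \<and>
     (\<forall>z\<in>unit_disk. f z = h z + cnj (g z)) \<and>
     (\<forall>z\<in>unit_disk. (\<lambda>n. a (Suc n) * z ^ Suc n) sums h z) \<and>
     (\<forall>z\<in>unit_disk. (\<lambda>n. b (Suc n) * z ^ Suc n) sums g z)"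

lemma has_derivative_harmonic:
  assumes "h holomorphic_on unit_disk" "g holomorphic_on unit_disk"
    and "\<And>z. z \<in> unit_disk \<Longrightarrow> f z = h z + cnj (g z)" and z: "z \<in> unit_disk"
  shows "(f has_derivative (\<lambda>v. deriv h z * v + cnj (deriv g z * v))) (at z)"
proof -
  have "(h has_derivative (*) (deriv h z)) (at z)" "(g has_derivative (*) (deriv g z)) (at z)"
    using assms holomorphic_derivI[OF _ open_ball z] by (simp_all add: has_field_derivative_def)
  then have "((\<lambda>z. h z + cnj (g z)) has_derivative (\<lambda>v. deriv h z * v + cnj (deriv g z * v))) (at z)"
    by (intro derivative_intros has_derivative_cnj)
  then show ?thesis
    by (rule has_derivative_transform_within_open[OF _ open_ball z]) (simp add: assms)
qed

lemma wirt_harmonic: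
  assumes "h holomorphic_on unit_disk" "g holomorphic_on unit_disk"
    and "\<And>z. z \<in> unit_disk \<Longrightarrow> f z = h z + cnj (g z)" and "z \<in> unit_disk"
  shows "wirt_z f z = deriv h z" and "wirt_zbar f z = cnj (deriv g z)"
  using frechet_derivative_at[OF has_derivative_harmonic[OF assms], symmetric]
  by (simp_all add: wirt_z_def wirt_zbar_def algebra_simps)

lemma emeasure_area_measure_disk: "emeasure area_measure unit_disk = 1"
proof -
  have "emeasure lborel unit_disk \<noteq> 0"
    by (simp add: emeasure_ball unit_ball_vol_def Gamma_numeral)
  moreover have "emeasure lborel unit_disk \<noteq> \<infinity>"
    using emeasure_lborel_ball_finite[of "0::complex" 1] by simp
  ultimately show ?thesis
    unfolding area_measure_def by (simp add: emeasure_uniform_measure ennreal_divide_self top.not_eq_extremum)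
qed

end

theory Submission imports Defs begin

text \<open>
  Since the Jacobian is \<open>J = \<Lambda>\<lambda>\<close> and \<open>\<Lambda> \<le> K\<lambda>\<close>, we have \<open>\<Lambda>\<^sup>2 \<le> K J\<close>, so for every unimodular
  \<open>c\<close> the analytic function \<open>F' = h' + c g'\<close> satisfies \<open>\<integral> |F'|\<^sup>2 dA \<le> C K\<close>.  The mean value property
  of \<open>F'\<^sup>2\<close> on disks around \<open>z\<close> gives \<open>(1 - |z|) |F'(z)| \<le> sqrt (C K)\<close>, hence the Bloch property
  by integrating along hyperbolic geodesics, and the coefficient estimates by Cauchy's
  inequality on the circle of radius \<open>(n - 1) / n\<close>, with \<open>c\<close> chosen such that
  \<open>|a_n + c b_n| = |a_n| + |b_n|\<close>.  The constant obtained this way is \<open>1\<close> in place of \<open>4 / \<pi>\<close>.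
  The mean value property over disks follows from the invariance of Lebesgue measure under
  rotations, which makes the integrals of the nonconstant monomials vanish.
\<close>

section \<open>Lebesgue measure on the plane and its invariance under rotations\<close>

lemma measurable_Complex [measurable]:
  "(\<lambda>(x, y). Complex x y) \<in> borel_measurable (lborel \<Otimes>\<^sub>M lborel)"
proof -
  have "(\<lambda>(x, y). Complex x y) \<in> borel_measurable (borel :: (real \<times> real) measure)"
    by (intro borel_measurable_continuous_onI) (auto simp: Complex_eq split_beta intro!: continuous_intros)
  then show ?thesis by (simp add: lborel_prod)
qed

text \<open>Lebesgue measure is determined by its values on boxes, and \<open>Complex\<close> pulls
  a box back to a product of intervals. This makes Tonelli's theorem in real coordinates available
  on \<open>complex\<close>.\<close>

lemma lborel_complex_eq_distr:
  "(lborel :: complex measure) = distr (lborel \<Otimes>\<^sub>M lborel) borel (\<lambda>(x, y). Complex x y)"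
proof (rule lborel_eqI)
  fix l u :: complex
  assume le: "\<And>b. b \<in> Basis \<Longrightarrow> l \<bullet> b \<le> u \<bullet> b"
  have Re: "Re l \<le> Re u" and Im: "Im l \<le> Im u"
    using le[of 1] le[of \<i>] by (auto simp: Basis_complex_def)
  have v: "(\<lambda>(x, y). Complex x y) -` box l u = box (Re l, Im l) (Re u, Im u)"
    by (auto simp: box_def Basis_complex_def Basis_prod_def)
  show "emeasure (distr (lborel \<Otimes>\<^sub>M lborel) borel (\<lambda>(x, y). Complex x y)) (box l u) =
      ennreal (\<Prod>b\<in>Basis. (u - l) \<bullet> b)"
    using Re Im measurable_Complex unfolding lborel_prod
    by (subst emeasure_distr)
      (simp_all add: v emeasure_lborel_box_eq Basis_prod_def Basis_complex_def prod.union_disjoint)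
qed simp

text \<open>Cavalieri's principle, by vertical slices in the first part and by horizontal slices in
  the second.\<close>

lemma emeasure_lborel_complex:
  assumes "A \<in> sets borel"
  shows "emeasure lborel A = (\<integral>\<^sup>+x. emeasure lborel {y. Complex x y \<in> A} \<partial>lborel)"
    and "emeasure lborel A = (\<integral>\<^sup>+y. emeasure lborel {x. Complex x y \<in> A} \<partial>lborel)"
proof -
  let ?V = "(\<lambda>(x, y). Complex x y) -` A"
  have V: "?V \<in> sets (lborel \<Otimes>\<^sub>M lborel)"
    using measurable_sets[OF measurable_Complex assms] by (simp add: space_pair_measure)
  have e: "emeasure lborel A = emeasure (lborel \<Otimes>\<^sub>M lborel) ?V"
    by (subst lborel_complex_eq_distr, subst emeasure_distr) (use assms in \<open>auto simp: space_pair_measure\<close>)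
  show "emeasure lborel A = (\<integral>\<^sup>+x. emeasure lborel {y. Complex x y \<in> A} \<partial>lborel)"
    unfolding e lborel.emeasure_pair_measure_alt[OF V]
    by (intro nn_integral_cong arg_cong[where f="emeasure lborel"]) auto
  show "emeasure lborel A = (\<integral>\<^sup>+y. emeasure lborel {x. Complex x y \<in> A} \<partial>lborel)"
    unfolding e lborel_pair.emeasure_pair_measure_alt2[OF V]
    by (intro nn_integral_cong arg_cong[where f="emeasure lborel"]) auto
qed

lemma emeasure_lborel_translate_vimage:
  fixes c :: "'a::euclidean_space"
  assumes "B \<in> sets borel"
  shows "emeasure lborel ((+) c -` B) = emeasure lborel B"
proof -
  have "emeasure lborel B = emeasure (distr lborel borel ((+) c)) B"
    by (simp add: lborel_distr_plus)
  also have "\<dots> = emeasure lborel ((+) c -` B)"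
    using assms by (subst emeasure_distr) auto
  finally show ?thesis by simp
qed

text \<open>The shear translates the horizontal line at height \<open>y\<close> by
  \<open>t * y\<close>, so each horizontal slice keeps its length and Cavalieri's principle
  applies.\<close>

lemma distr_lborel_shear_Re:
  "distr lborel borel (\<lambda>z. z + of_real (t * Im z)) = (lborel :: complex measure)"
proof (rule measure_eqI)
  fix A :: "complex set"
  assume "A \<in> sets (distr lborel borel (\<lambda>z. z + of_real (t * Im z)))"
  then have A: "A \<in> sets borel" by simp
  have m: "(\<lambda>z::complex. z + of_real (t * Im z)) \<in> borel_measurable borel"
    by (intro borel_measurable_continuous_onI continuous_intros)
  have s: "{x. Complex x y \<in> A} \<in> sets borel" for y
  proof -
    have "(\<lambda>x. Complex x y) \<in> borel_measurable borel"
      by (intro borel_measurable_continuous_onI) (auto simp: Complex_eq intro!: continuous_intros)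
    from measurable_sets[OF this A] show ?thesis by (simp add: vimage_def)
  qed
  have "emeasure (distr lborel borel (\<lambda>z. z + of_real (t * Im z))) A =
      emeasure lborel ((\<lambda>z. z + of_real (t * Im z)) -` A)"
    using A m by (subst emeasure_distr) auto
  also have "\<dots> = (\<integral>\<^sup>+y. emeasure lborel {x. Complex x y \<in> (\<lambda>z. z + of_real (t * Im z)) -` A} \<partial>lborel)"
    using measurable_sets[OF m A] by (intro emeasure_lborel_complex(2)) simp
  also have "\<dots> = (\<integral>\<^sup>+y. emeasure lborel {x. Complex x y \<in> A} \<partial>lborel)"
  proof (intro nn_integral_cong)
    fix y :: real
    have "{x. Complex x y \<in> (\<lambda>z. z + of_real (t * Im z)) -` A} = (+) (t * y) -` {x. Complex x y \<in> A}"
      by (auto simp: Complex_eq algebra_simps)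
    then show "emeasure lborel {x. Complex x y \<in> (\<lambda>z. z + of_real (t * Im z)) -` A} =
        emeasure lborel {x. Complex x y \<in> A}"
      using emeasure_lborel_translate_vimage[OF s] by simp
  qed
  also have "\<dots> = emeasure lborel A"
    using A by (rule emeasure_lborel_complex(2)[symmetric])
  finally show "emeasure (distr lborel borel (\<lambda>z. z + of_real (t * Im z))) A = emeasure lborel A" .
qed simp

text \<open>The same argument with vertical slices: the line with real part \<open>x\<close> is
  translated by \<open>t * x\<close>.\<close>

lemma distr_lborel_shear_Im:
  "distr lborel borel (\<lambda>z. z + \<i> * of_real (t * Re z)) = (lborel :: complex measure)"
proof (rule measure_eqI)
  fix A :: "complex set"
  assume "A \<in> sets (distr lborel borel (\<lambda>z. z + \<i> * of_real (t * Re z)))"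
  then have A: "A \<in> sets borel" by simp
  have m: "(\<lambda>z::complex. z + \<i> * of_real (t * Re z)) \<in> borel_measurable borel"
    by (intro borel_measurable_continuous_onI continuous_intros)
  have s: "{y. Complex x y \<in> A} \<in> sets borel" for x
  proof -
    have "(\<lambda>y. Complex x y) \<in> borel_measurable borel"
      by (intro borel_measurable_continuous_onI) (auto simp: Complex_eq intro!: continuous_intros)
    from measurable_sets[OF this A] show ?thesis by (simp add: vimage_def)
  qed
  have "emeasure (distr lborel borel (\<lambda>z. z + \<i> * of_real (t * Re z))) A =
      emeasure lborel ((\<lambda>z. z + \<i> * of_real (t * Re z)) -` A)"
    using A m by (subst emeasure_distr) auto
  also have "\<dots> = (\<integral>\<^sup>+x. emeasure lborel {y. Complex x y \<in> (\<lambda>z. z + \<i> * of_real (t * Re z)) -` A} \<partial>lborel)"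
    using measurable_sets[OF m A] by (intro emeasure_lborel_complex(1)) simp
  also have "\<dots> = (\<integral>\<^sup>+x. emeasure lborel {y. Complex x y \<in> A} \<partial>lborel)"
  proof (intro nn_integral_cong)
    fix x :: real
    have "{y. Complex x y \<in> (\<lambda>z. z + \<i> * of_real (t * Re z)) -` A} = (+) (t * x) -` {y. Complex x y \<in> A}"
      by (auto simp: Complex_eq algebra_simps)
    then show "emeasure lborel {y. Complex x y \<in> (\<lambda>z. z + \<i> * of_real (t * Re z)) -` A} =
        emeasure lborel {y. Complex x y \<in> A}"
      using emeasure_lborel_translate_vimage[OF s] by simp
  qed
  also have "\<dots> = emeasure lborel A"
    using A by (rule emeasure_lborel_complex(1)[symmetric])
  finally show "emeasure (distr lborel borel (\<lambda>z. z + \<i> * of_real (t * Re z))) A = emeasure lborel A" .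
qed simp

lemma distr_lborel_comp:
  assumes "distr lborel borel f = (lborel :: 'a::euclidean_space measure)" "f \<in> borel_measurable borel"
    and "distr lborel borel g = (lborel :: 'a measure)" "g \<in> borel_measurable borel"
  shows "distr lborel borel (f \<circ> g) = (lborel :: 'a measure)"
proof -
  have "distr lborel borel (f \<circ> g) = distr (distr lborel borel g) borel f"
    using assms by (subst distr_distr) auto
  then show ?thesis using assms by simp
qed

text \<open>A rotation other than the half turn is a product of three shears.\<close>

lemma distr_lborel_rotation:
  assumes u: "cmod u = 1"
  shows "distr lborel borel ((*) u) = (lborel :: complex measure)"
proof -
  have rot: "distr lborel borel ((*) u) = (lborel :: complex measure)"
    if u: "cmod u = 1" and n: "u \<noteq> -1" for u
  proof -
    \<comment> \<open>For \<open>u = cis \<theta>\<close> this is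
      \<open>- tan (\<theta> / 2)\<close>. The outer shears use the parameter \<open>t\<close> and
      the middle one uses \<open>Im u\<close>, which is \<open>sin \<theta>\<close>; the identities
      \<open>1\<close> and \<open>2\<close> below match the coefficients of the product with those
      of the rotation.\<close>
    define t where "t = - Im u / (1 + Re u)"
    have sq: "(Re u)\<^sup>2 + (Im u)\<^sup>2 = 1"
      using u cmod_power2[of u] by simp
    have nz: "1 + Re u \<noteq> 0"
    proof
      assume "1 + Re u = 0"
      then have "Re u = -1" by simp
      with sq n show False by (simp add: complex_eq_iff)
    qed
    have 1: "1 + t * Im u = Re u" and 2: "t * (1 + Re u) = - Im u"
      using nz sq by (simp_all add: t_def divide_simps power2_eq_square) (simp add: algebra_simps)
    let ?S = "\<lambda>z::complex. z + of_real (t * Im z)"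
    let ?T = "\<lambda>z::complex. z + \<i> * of_real (Im u * Re z)"
    have "(*) u = ?S \<circ> (?T \<circ> ?S)"
    proof
      fix z
      have "Re u * Re z - Im u * Im z = (1 + t * Im u) * Re z + t * (1 + (1 + t * Im u)) * Im z"
        unfolding 1 2 by simp
      moreover have "Re u * Im z + Im u * Re z = (1 + t * Im u) * Im z + Im u * Re z"
        unfolding 1 by simp
      ultimately show "u * z = (?S \<circ> (?T \<circ> ?S)) z"
        by (simp add: complex_eq_iff algebra_simps)
    qed
    moreover have "?S \<in> borel_measurable borel" "?T \<in> borel_measurable borel"
      "?T \<circ> ?S \<in> borel_measurable borel"
      by (auto simp: o_def intro!: borel_measurable_continuous_onI continuous_intros)
    ultimately show ?thesis
      by (simp only: distr_lborel_comp distr_lborel_shear_Re distr_lborel_shear_Im)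
  qed
  show ?thesis
  proof (cases "u = -1")
    \<comment> \<open>Here the denominator of \<open>t\<close> would vanish, so the half turn is
      written as the square of the quarter turn.\<close>
    case True
    have "(*) u = (*) \<i> \<circ> (*) \<i>"
      by (simp add: True fun_eq_iff)
    moreover have "\<i> \<noteq> -1" by (simp add: complex_eq_iff)
    moreover have "(*) \<i> \<in> borel_measurable borel"
      by (intro borel_measurable_continuous_onI continuous_intros)
    ultimately show ?thesis
      by (simp only: distr_lborel_comp rot norm_ii not_False_eq_True)
  qed (use u rot in simp)
qed

section \<open>Mean value property over disks\<close>

lemma set_integrable_continuous_ball:
  fixes f :: "complex \<Rightarrow> 'b::{banach,second_countable_topology}"
  assumes "continuous_on (cball z r) f"
  shows "set_integrable lborel (ball z r) f"
proof -
  have "set_integrable lborel (cball z r) f"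
    unfolding set_integrable_def using assms by (intro borel_integrable_compact) auto
  then show ?thesis
    by (rule set_integrable_subset) auto
qed

text \<open>For a disk centred at 0, rotation by \<open>u\<close> with \<open>u ^ n = -1\<close>
  preserves the disk and the measure but flips the sign of the integrand, so the integral equals its
  own negative. A translation then handles an arbitrary centre.\<close>

lemma integral_power_ball:
  fixes z :: complex
  assumes "n > 0"
  shows "(LINT w:ball z r|lborel. (w - z) ^ n) = 0"
proof -
  define I where "I = (LINT w:ball 0 r|lborel. w ^ n :: complex)"
  define u where "u = cis (pi / n)"
  have u: "cmod u = 1" "u ^ n = -1"
    using assms by (simp_all add: u_def Complex.DeMoivre cis_pi)
  have "I = integral\<^sup>L (distr lborel borel ((*) u)) (\<lambda>w. indicator (ball 0 r) w *\<^sub>R w ^ n)"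
    by (simp add: I_def set_lebesgue_integral_def distr_lborel_rotation u)
  also have "\<dots> = (LINT w|lborel. indicator (ball 0 r) (u * w) *\<^sub>R (u * w) ^ n)"
    by (intro integral_distr borel_measurable_scaleR borel_measurable_indicator borel_measurable_power) auto
  also have "\<dots> = (LINT w|lborel. - (indicator (ball 0 r) w *\<^sub>R w ^ n))"
    by (intro Bochner_Integration.integral_cong)
      (auto simp: power_mult_distrib u norm_mult indicator_def)
  also have "\<dots> = - I" by (simp add: I_def set_lebesgue_integral_def)
  finally have "I = 0" by simp
  have "(LINT w:ball z r|lborel. (w - z) ^ n) =
      integral\<^sup>L (distr lborel borel ((+) z)) (\<lambda>w. indicator (ball z r) w *\<^sub>R (w - z) ^ n)"
    by (simp add: set_lebesgue_integral_def lborel_distr_plus)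
  also have "\<dots> = (LINT w|lborel. indicator (ball z r) (z + w) *\<^sub>R (z + w - z) ^ n)"
    by (intro integral_distr borel_measurable_scaleR borel_measurable_indicator
        borel_measurable_continuous_onI continuous_intros) auto
  also have "\<dots> = I"
    unfolding I_def set_lebesgue_integral_def
    by (intro Bochner_Integration.integral_cong) (auto simp: indicator_def dist_norm)
  finally show ?thesis using \<open>I = 0\<close> by simp
qed

lemma measure_ball_complex:
  assumes "r \<ge> 0"
  shows "measure lborel (ball (z::complex) r) = pi * r\<^sup>2"
  using content_ball[OF assms, of z] assms
  by (simp add: unit_ball_vol_def Gamma_numeral measure_def)

text \<open>The Taylor series at the centre is integrated term by term, and only the constant term
  survives.\<close>

lemma disk_mean_value:
  assumes F: "F holomorphic_on ball z R" and r: "0 < r" "r < R"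
  shows "(LINT w:ball z r|lborel. F w) = of_real (pi * r\<^sup>2) * F z"
proof -
  define c where "c n = (deriv ^^ n) F z / fact n" for n
  define q where "q n w = indicator (ball z r) w *\<^sub>R (c n * (w - z) ^ n)" for n w
  have ser: "(\<lambda>n. c n * (w - z) ^ n) sums F w" if "w \<in> ball z R" for w
    unfolding c_def using holomorphic_power_series[OF F that] .
  \<comment> \<open>The series converges at distance \<open>(r + R) / 2 > r\<close> from the centre,
    hence absolutely at distance \<open>r\<close>. This one majorant serves both summability
    conditions for exchanging sum and integral.\<close>
  have sm: "summable (\<lambda>n. norm (c n) * r ^ n)"
  proof -
    have "z + of_real ((r + R) / 2) \<in> ball z R"
      using r by (simp add: dist_norm del: of_real_add of_real_divide)
    from sums_summable[OF ser[OF this]]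
    have "summable (\<lambda>n. c n * (of_real ((r + R) / 2)) ^ n)" by simp
    then have "summable (\<lambda>n. norm (c n * (of_real r) ^ n))"
      by (rule powser_insidea) (use r in \<open>simp del: of_real_add of_real_divide\<close>)
    then show ?thesis using r by (simp add: norm_mult norm_power)
  qed
  have int: "integrable lborel (q n)" for n
    using set_integrable_continuous_ball[of z r "\<lambda>w. c n * (w - z) ^ n"]
    by (simp add: q_def[abs_def] set_integrable_def continuous_intros)
  have bd: "norm (q n w) \<le> norm (c n) * r ^ n" for n w
    using r by (auto simp: q_def indicator_def norm_mult norm_power dist_norm norm_minus_commute
        intro!: mult_left_mono power_mono)
  have ind: "integrable lborel (indicator (ball z r) :: complex \<Rightarrow> real)"
    using emeasure_lborel_ball_finite[of z r] by simp
  have "(\<lambda>n. LINT w|lborel. q n w) sums (LINT w|lborel. (\<Sum>n. q n w))"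
  proof (rule sums_integral[OF int])
    show "AE w in lborel. summable (\<lambda>n. norm (q n w))"
      by (intro AE_I2 summable_comparison_test[OF _ sm]) (use bd in auto)
    have "(LINT w|lborel. norm (q n w)) \<le> norm (c n) * r ^ n * (pi * r\<^sup>2)" for n
    proof -
      have "(LINT w|lborel. norm (q n w)) \<le> (LINT w|lborel. (norm (c n) * r ^ n) * indicator (ball z r) w)"
        proof (intro integral_mono integrable_norm[OF int] integrable_mult_right ind)
        fix w
        show "norm (q n w) \<le> norm (c n) * r ^ n * indicator (ball z r) w"
          using bd[of n w] by (auto simp: q_def indicator_def)
      qed
      also have "\<dots> = norm (c n) * r ^ n * (pi * r\<^sup>2)"
        using r by (simp add: measure_ball_complex)
      finally show ?thesis .
    qed
    then show "summable (\<lambda>n. LINT w|lborel. norm (q n w))"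
      by (intro summable_comparison_test[OF _ summable_mult2[OF sm]]) auto
  qed
  moreover have "(LINT w|lborel. (\<Sum>n. q n w)) = (LINT w:ball z r|lborel. F w)"
    unfolding set_lebesgue_integral_def
  proof (intro Bochner_Integration.integral_cong refl)
    fix w
    show "(\<Sum>n. q n w) = indicator (ball z r) w *\<^sub>R F w"
      using sums_unique[OF ser[of w]] r by (auto simp: q_def indicator_def)
  qed
  moreover have "(LINT w|lborel. q n w) = (if n = 0 then of_real (pi * r\<^sup>2) * F z else 0)" for n
  proof (cases "n = 0")
    case True
    have "(LINT w|lborel. q 0 w) = (LINT w|lborel. indicator (ball z r) w *\<^sub>R F z)"
      by (simp add: q_def c_def)
    also have "\<dots> = of_real (pi * r\<^sup>2) * F z"
      using r ind by (subst integral_scaleR_left) (simp_all add: measure_ball_complex scaleR_conv_of_real)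
    finally show ?thesis using True by simp
  next
    case False
    have "(LINT w|lborel. q n w) = (LINT w|lborel. c n * (indicator (ball z r) w *\<^sub>R (w - z) ^ n))"
      by (simp add: q_def)
    also have "\<dots> = c n * (LINT w:ball z r|lborel. (w - z) ^ n)"
      by (simp only: set_lebesgue_integral_def integral_mult_right_zero)
    finally have "(LINT w|lborel. q n w) = c n * (LINT w:ball z r|lborel. (w - z) ^ n)" .
    then show ?thesis using integral_power_ball[of n z r] False by simp
  qed
  ultimately have "(\<lambda>n. if n = 0 then of_real (pi * r\<^sup>2) * F z else 0) sums (LINT w:ball z r|lborel. F w)"
    by simp
  then show ?thesis
    using sums_unique2[OF _ sums_single[of 0 "\<lambda>_. of_real (pi * r\<^sup>2) * F z"]] by simp
qed

text \<open>The mean value property is applied to the holomorphic function \<open>F\<^sup>2\<close>,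
  and the modulus is then taken inside the integral.\<close>

lemma disk_submean_value_power2:
  assumes F: "F holomorphic_on ball z R" and r: "0 < r" "r < R"
  shows "pi * r\<^sup>2 * (cmod (F z))\<^sup>2 \<le> (LINT w:ball z r|lborel. (cmod (F w))\<^sup>2)"
proof -
  have "(\<lambda>w. (F w)\<^sup>2) holomorphic_on ball z R"
    using F by (intro holomorphic_intros)
  from disk_mean_value[OF this r]
  have "pi * r\<^sup>2 * (cmod (F z))\<^sup>2 = cmod (LINT w:ball z r|lborel. (F w)\<^sup>2)"
    by (simp add: norm_mult norm_power)
  also have "\<dots> \<le> (LINT w|lborel. norm (indicator (ball z r) w *\<^sub>R (F w)\<^sup>2))"
    unfolding set_lebesgue_integral_def by (rule integral_norm_bound)
  also have "\<dots> = (LINT w:ball z r|lborel. (cmod (F w))\<^sup>2)"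
    unfolding set_lebesgue_integral_def by (simp add: norm_power)
  finally show ?thesis .
qed

section \<open>From the area integral to a pointwise bound on derivatives\<close>

text \<open>The normalized measure has density \<open>1 / pi\<close> on the unit disk, which
  contains \<open>ball 0 r\<close>. Continuity of \<open>G\<close> up to the boundary circle
  supplies integrability.\<close>

lemma area_S_eq_integral:
  assumes r: "0 < r" "r < 1" and G: "continuous_on (cball 0 r) G"
    and J: "\<And>z. z \<in> ball 0 r \<Longrightarrow> jacobian f z = G z"
  shows "area_S f r = (LINT z:ball 0 r|lborel. G z) / pi"
proof -
  have disk: "emeasure lborel (ball (0::complex) 1) = ennreal pi"
    by (simp add: emeasure_ball unit_ball_vol_def Gamma_numeral)
  have um: "area_measure = density lborel (\<lambda>z. ennreal (indicator unit_disk z / pi))"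
    unfolding area_measure_def uniform_measure_def disk
    by (intro density_cong AE_I2) (auto simp: indicator_def divide_ennreal ennreal_1[symmetric] simp del: ennreal_1)
  have int: "integrable lborel (\<lambda>z. indicator (ball 0 r) z *\<^sub>R G z)"
    using set_integrable_continuous_ball[OF G] by (simp add: set_integrable_def)
  have "area_S f r = (LINT z|area_measure. indicator (ball 0 r) z *\<^sub>R G z)"
    unfolding area_S_def set_lebesgue_integral_def
    by (intro Bochner_Integration.integral_cong) (auto simp: J indicator_def)
  also have "\<dots> = (LINT z|lborel. (indicator unit_disk z / pi) *\<^sub>R (indicator (ball 0 r) z *\<^sub>R G z))"
    unfolding um using int
    by (intro integral_density borel_measurable_divide borel_measurable_indicator) auto
  also have "\<dots> = (LINT z|lborel. (indicator (ball 0 r) z *\<^sub>R G z) / pi)"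
    using r by (intro Bochner_Integration.integral_cong) (auto simp: indicator_def)
  finally show ?thesis
    by (simp add: set_lebesgue_integral_def)
qed

text \<open>The Jacobian factors as a difference of squares. Strict sense preservation makes
  \<open>lambda_min\<close> positive, so the quotient in the quasiregularity condition can be
  cleared and multiplied by \<open>Lambda_max\<close>.\<close>

lemma quasiregular_Lambda_max_power2_le:
  assumes "quasiregular_harmonic K f" "z \<in> unit_disk"
  shows "(Lambda_max f z)\<^sup>2 \<le> K * jacobian f z" "jacobian f z \<ge> 0"
proof -
  have lt: "cmod (wirt_zbar f z) < cmod (wirt_z f z)" and le: "Lambda_max f z / lambda_min f z \<le> K"
    using assms by (auto simp: quasiregular_harmonic_def sense_preserving_def)
  have J: "jacobian f z = Lambda_max f z * lambda_min f z"
    using lt by (simp add: jacobian_def Lambda_max_def lambda_min_def power2_eq_square algebra_simps)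
  have pos: "lambda_min f z > 0" "Lambda_max f z \<ge> 0"
    using lt by (simp_all add: lambda_min_def Lambda_max_def)
  then have "Lambda_max f z \<le> K * lambda_min f z"
    using le by (simp add: pos_divide_le_eq)
  from mult_left_mono[OF this pos(2)]
  show "(Lambda_max f z)\<^sup>2 \<le> K * jacobian f z"
    by (simp add: J power2_eq_square algebra_simps)
  show "jacobian f z \<ge> 0" using pos by (simp add: J)
qed

lemma quasiregular_derivative_bound:
  assumes qr: "quasiregular_harmonic K f"
    and h: "h holomorphic_on unit_disk" and g: "g holomorphic_on unit_disk"
    and f: "\<And>z. z \<in> unit_disk \<Longrightarrow> f z = h z + cnj (g z)"
    and C: "\<And>r. 0 < r \<Longrightarrow> r < 1 \<Longrightarrow> area_S f r \<le> C"
    and c: "cmod c \<le> 1" and z: "z \<in> unit_disk"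
  shows "(1 - cmod z) * cmod (deriv h z + c * deriv g z) \<le> sqrt (C * K)"
proof -
  define F where "F = (\<lambda>w. deriv h w + c * deriv g w)"
  define G where "G = (\<lambda>w. (cmod (deriv h w))\<^sup>2 - (cmod (deriv g w))\<^sup>2)"
  have K: "K \<ge> 1" using qr by (simp add: quasiregular_harmonic_def)
  have hol: "deriv h holomorphic_on unit_disk" "deriv g holomorphic_on unit_disk"
    using holomorphic_deriv[OF h open_ball] holomorphic_deriv[OF g open_ball] by simp_all
  then have F: "F holomorphic_on unit_disk"
    unfolding F_def by (intro holomorphic_on_add holomorphic_on_mult holomorphic_on_const)
  have contG: "continuous_on unit_disk G"
    unfolding G_def using holomorphic_on_imp_continuous_on[OF hol(1)] holomorphic_on_imp_continuous_on[OF hol(2)]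
    by (intro continuous_on_diff continuous_on_power continuous_on_norm)
  have J: "jacobian f w = G w" if "w \<in> unit_disk" for w
    using wirt_harmonic[OF h g f that] by (simp add: jacobian_def G_def)
  have G0: "G w \<ge> 0" if "w \<in> unit_disk" for w
    using quasiregular_Lambda_max_power2_le(2)[OF qr that] J[OF that] by simp
  have FG: "(cmod (F w))\<^sup>2 \<le> K * G w" if "w \<in> unit_disk" for w
  proof -
    have "cmod (F w) \<le> cmod (deriv h w) + cmod c * cmod (deriv g w)"
      unfolding F_def by (metis norm_mult norm_triangle_ineq)
    also have "\<dots> \<le> Lambda_max f w"
      using wirt_harmonic[OF h g f that] c by (simp add: Lambda_max_def mult_left_le_one_le)
    finally have "(cmod (F w))\<^sup>2 \<le> (Lambda_max f w)\<^sup>2" by (intro power_mono) auto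
    also have "\<dots> \<le> K * G w"
      using quasiregular_Lambda_max_power2_le(1)[OF qr that] J[OF that] by simp
    finally show ?thesis .
  qed
  have bound: "\<rho> * cmod (F z) \<le> sqrt (C * K)" if \<rho>: "0 < \<rho>" "\<rho> < 1 - cmod z" for \<rho>
  proof -
    \<comment> \<open>The centred disk of this radius contains \<open>ball z \<rho>\<close>, and
      \<open>r < 1\<close> makes the area bound applicable.\<close>
    define r where "r = cmod z + \<rho>"
    have r: "0 < r" "r < 1" using \<rho> by (simp_all add: r_def add_nonneg_pos)
    have sub: "ball z \<rho> \<subseteq> ball 0 r" "cball z \<rho> \<subseteq> unit_disk" "cball 0 r \<subseteq> unit_disk"
      "ball z (1 - cmod z) \<subseteq> unit_disk"
      using r \<rho> by (auto simp: r_def cball_subset_ball_iff ball_subset_ball_iff)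
    have intF: "set_integrable lborel (ball z \<rho>) (\<lambda>w. (cmod (F w))\<^sup>2)"
      using F sub by (intro set_integrable_continuous_ball continuous_intros)
        (auto intro: holomorphic_on_imp_continuous_on continuous_on_subset)
    have intG: "set_integrable lborel (ball 0 r) (\<lambda>w. K * G w)"
      using contG sub by (intro set_integrable_continuous_ball continuous_intros)
        (auto intro: continuous_on_subset)
    have "pi * \<rho>\<^sup>2 * (cmod (F z))\<^sup>2 \<le> (LINT w:ball z \<rho>|lborel. (cmod (F w))\<^sup>2)"
      using disk_submean_value_power2[OF holomorphic_on_subset[OF F sub(4)] \<rho>] .
    \<comment> \<open>Inside \<open>ball z \<rho>\<close> this is \<open>FG\<close>; on the rest of
      the larger disk it uses that the Jacobian is nonnegative.\<close>
    also have "\<dots> \<le> (LINT w:ball 0 r|lborel. K * G w)"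
      unfolding set_lebesgue_integral_def
    proof (rule integral_mono)
      fix w
      show "indicator (ball z \<rho>) w *\<^sub>R (cmod (F w))\<^sup>2 \<le> indicator (ball 0 r) w *\<^sub>R (K * G w)"
        using sub FG[of w] G0[of w] K r by (auto simp: indicator_def)
    qed (use intF intG in \<open>simp_all add: set_integrable_def\<close>)
    also have "\<dots> = K * (pi * area_S f r)"
      using area_S_eq_integral[OF r continuous_on_subset[OF contG sub(3)] J] r by simp
    also have "\<dots> \<le> K * (pi * C)"
      using C[OF r] K by simp
    finally have "(\<rho> * cmod (F z))\<^sup>2 \<le> C * K"
      by (simp add: power_mult_distrib algebra_simps)
    then show ?thesis by (rule real_le_rsqrt)
  qed
  \<comment> \<open>Passage to the limit in \<open>bound\<close> as \<rho> tends to
    \<open>1 - cmod z\<close>: otherwise some admissible \<rho> exceeding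
    \<open>sqrt (C * K) / cmod (F z)\<close> would violate \<open>bound\<close>.\<close>
  have "(1 - cmod z) * cmod (F z) \<le> sqrt (C * K)"
  proof (rule ccontr)
    assume *: "\<not> ?thesis"
    \<comment> \<open>The sign of \<open>C * K\<close> is not given in advance; \<open>bound\<close>
      at half the limiting radius shows that the root is nonnegative.\<close>
    have "0 \<le> (1 - cmod z) / 2 * cmod (F z)" using z by simp
    also have "\<dots> \<le> sqrt (C * K)" using z by (intro bound) auto
    finally have s: "0 \<le> sqrt (C * K)" .
    with * have "cmod (F z) > 0" by (auto simp: not_le)
    with * have "sqrt (C * K) / cmod (F z) < 1 - cmod z"
      by (simp add: pos_divide_less_eq not_le)
    then obtain \<rho> where \<rho>: "sqrt (C * K) / cmod (F z) < \<rho>" "\<rho> < 1 - cmod z"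
      using dense by blast
    have "0 \<le> sqrt (C * K) / cmod (F z)" using s by simp
    with \<rho> bound[of \<rho>] \<open>cmod (F z) > 0\<close> show False by (simp add: pos_divide_less_eq)
  qed
  then show ?thesis by (simp add: F_def)
qed

section \<open>Hyperbolic distance and the Bloch property\<close>

lemma one_minus_cnj_mult_nonzero:
  assumes "cmod z < 1" "cmod w < 1"
  shows "1 - cnj z * w \<noteq> 0"
proof
  assume "1 - cnj z * w = 0"
  then have "cmod z * cmod w = 1"
    by (metis complex_mod_cnj norm_mult norm_one right_minus_eq)
  moreover have "cmod z * cmod w < 1 * 1"
    using assms by (intro mult_strict_mono') auto
  ultimately show False by simp
qed

text \<open>The derivative bound is integrated along the hyperbolic geodesic from \<open>z\<close>
  to \<open>w\<close>, which is the image of a radial segment under a disk automorphism.\<close>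

lemma Bloch_imp_hyperbolic_Lipschitz:
  assumes h: "h holomorphic_on unit_disk"
    and M: "\<And>z. z \<in> unit_disk \<Longrightarrow> (1 - (cmod z)\<^sup>2) * cmod (deriv h z) \<le> M"
    and z: "z \<in> unit_disk" and w: "w \<in> unit_disk"
  shows "cmod (h z - h w) \<le> M * hyp_dist z w"
proof -
  \<comment> \<open>The image of \<open>w\<close> under an automorphism sending \<open>z\<close> to
    0. The inverse automorphism carries the segment from 0 to \<xi> onto the geodesic
    \<open>\<phi>\<close>, with \<open>D\<close> as its denominator and \<open>\<phi>'\<close> as
    its velocity.\<close>
  define \<xi> where "\<xi> = (w - z) / (1 - cnj z * w)"
  define D where "D t = 1 + cnj z * (of_real t * \<xi>)" for t :: real
  define \<phi> where "\<phi> t = (of_real t * \<xi> + z) / D t" for t :: real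
  define \<phi>' where "\<phi>' t = (1 - cnj z * z) * \<xi> / (D t)\<^sup>2" for t :: real
  have zw: "cmod z < 1" "cmod w < 1" using z w by simp_all
  have \<xi>: "cmod \<xi> < 1"
    using Moebius_function_norm_lt_1[OF zw, of 0] by (simp add: \<xi>_def Moebius_function_simple)
  have t\<xi>: "cmod (of_real t * \<xi>) < 1" if "0 \<le> t" "t \<le> 1" for t
    using \<xi> that mult_left_le_one_le[of "cmod \<xi>" t] by (simp add: norm_mult)
  have D: "D t \<noteq> 0" if "0 \<le> t" "t \<le> 1" for t
    using one_minus_cnj_mult_nonzero[of "- z", OF _ t\<xi>[OF that]] zw by (simp add: D_def)
  note den = one_minus_cnj_mult_nonzero[OF zw]
  have \<phi>_mem: "\<phi> t \<in> unit_disk" if "0 \<le> t" "t \<le> 1" for t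
    using Moebius_function_norm_lt_1[OF _ t\<xi>[OF that], of "-z" 0] zw
    by (simp add: \<phi>_def D_def Moebius_function_simple)
  have ends: "\<phi> 0 = z" "\<phi> 1 = w"
  proof -
    show "\<phi> 0 = z" by (simp add: \<phi>_def D_def)
    note one_minus_cnj_mult_nonzero[OF zw(1) zw(1)]
    moreover have "\<xi> + z = w * (1 - cnj z * z) / (1 - cnj z * w)" "D 1 = (1 - cnj z * z) / (1 - cnj z * w)"
      using den by (simp_all add: \<xi>_def D_def field_simps)
    ultimately show "\<phi> 1 = w" using den by (simp add: \<phi>_def)
  qed
  have \<phi>': "(\<phi> has_vector_derivative \<phi>' t) (at t)" if "0 \<le> t" "t \<le> 1" for t
  proof -
    have "((\<lambda>s. (s * \<xi> + z) / (1 + cnj z * (s * \<xi>))) has_field_derivative \<phi>' t) (at (of_real t))"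
      using D[OF that] unfolding \<phi>'_def D_def
      by (auto intro!: derivative_eq_intros simp: power2_eq_square field_simps)
    from has_vector_derivative_real_field[OF this] show ?thesis
      by (simp add: \<phi>_def[abs_def] D_def)
  qed
  \<comment> \<open>Schwarz--Pick equality for the disk automorphism that carries \<open>t\<xi>\<close> to \<open>\<phi> t\<close>.\<close>
  have metric: "(1 - (cmod (\<phi> t))\<^sup>2) * cmod \<xi> = cmod (\<phi>' t) * (1 - (t * cmod \<xi>)\<^sup>2)"
    if "0 \<le> t" "t \<le> 1" for t
  proof -
    have "(cmod (D t))\<^sup>2 - (cmod (of_real t * \<xi> + z))\<^sup>2 = (1 - (cmod z)\<^sup>2) * (1 - (cmod (of_real t * \<xi>))\<^sup>2)"
      unfolding D_def cmod_power2 by (simp add: power2_eq_square algebra_simps)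
    moreover have "(1 - (cmod (\<phi> t))\<^sup>2) * (cmod (D t))\<^sup>2 = (cmod (D t))\<^sup>2 - (cmod (of_real t * \<xi> + z))\<^sup>2"
      using D[OF that] by (simp add: \<phi>_def norm_divide power_divide left_diff_distrib)
    ultimately have "(1 - (cmod (\<phi> t))\<^sup>2) * (cmod (D t))\<^sup>2 = (1 - (cmod z)\<^sup>2) * (1 - (t * cmod \<xi>)\<^sup>2)"
      by (simp add: norm_mult power_mult_distrib)
    moreover have "cmod (\<phi>' t) = (1 - (cmod z)\<^sup>2) * cmod \<xi> / (cmod (D t))\<^sup>2"
    proof -
      have "0 \<le> 1 - (cmod z)\<^sup>2" using zw by (simp add: abs_square_le_1)
      moreover have "\<phi>' t = of_real (1 - (cmod z)\<^sup>2) * \<xi> / (D t)\<^sup>2" by (simp add: \<phi>'_def complex_norm_square mult.commute del: of_real_power)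
      ultimately show ?thesis by (simp only: norm_divide norm_mult norm_power norm_of_real abs_of_nonneg)
    qed
    moreover have "1 - (cmod (\<phi> t))\<^sup>2 = (1 - (cmod z)\<^sup>2) * (1 - (t * cmod \<xi>)\<^sup>2) / (cmod (D t))\<^sup>2"
      using D[OF that] calculation(1) by (simp add: eq_divide_eq)
    ultimately show ?thesis by simp
  qed
  \<comment> \<open>A mean value inequality with a real majorant: the speed of \<open>h\<close>
    along the geodesic is at most the derivative of \<open>M * artanh (t * cmod \<xi>)\<close>,
    whose total increase is \<open>M * hyp_dist z w\<close>.\<close>
  have "norm ((h \<circ> \<phi>) 1 - (h \<circ> \<phi>) 0) \<le> M * artanh (1 * cmod \<xi>) - M * artanh (0 * cmod \<xi>)"
  proof (rule differentiable_bound_general[where f' = "\<lambda>t. \<phi>' t * deriv h (\<phi> t)"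
        and \<phi> = "\<lambda>t. M * artanh (t * cmod \<xi>)" and \<phi>' = "\<lambda>t. M * (cmod \<xi> / (1 - (t * cmod \<xi>)\<^sup>2))"])
    have d: "((h \<circ> \<phi>) has_vector_derivative \<phi>' t * deriv h (\<phi> t)) (at t)" if "0 \<le> t" "t \<le> 1" for t
      using \<phi>'[OF that] holomorphic_derivI[OF h open_ball \<phi>_mem[OF that]] by (rule field_vector_diff_chain_at)
    show "continuous_on {0..1} (h \<circ> \<phi>)"
      by (intro continuous_at_imp_continuous_on ballI has_vector_derivative_continuous[OF d]) auto
    have ar: "t * cmod \<xi> < 1" "0 \<le> t * cmod \<xi>" if "0 \<le> t" "t \<le> 1" for t
      using t\<xi>[OF that] that by (simp_all add: norm_mult)
    show "continuous_on {0..1} (\<lambda>t. M * artanh (t * cmod \<xi>))"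
      using ar by (intro continuous_intros) (auto intro: less_le_trans[of "-1" 0])
    fix t :: real assume t: "0 < t" "t < 1"
    show "((h \<circ> \<phi>) has_vector_derivative \<phi>' t * deriv h (\<phi> t)) (at t)"
      using d t by simp
    have a: "\<bar>t * cmod \<xi>\<bar> < 1" using ar[of t] t by simp
    have "((\<lambda>t. artanh (t * cmod \<xi>)) has_real_derivative 1 / (1 - (t * cmod \<xi>)\<^sup>2) * cmod \<xi>) (at t)"
      by (rule DERIV_chain2[where f = artanh and g = "\<lambda>t. t * cmod \<xi>" and x = t, OF artanh_real_has_field_derivative[OF a]]) (auto intro!: derivative_eq_intros)
    from DERIV_cmult[OF this, of M]
    show "((\<lambda>t. M * artanh (t * cmod \<xi>)) has_vector_derivative M * (cmod \<xi> / (1 - (t * cmod \<xi>)\<^sup>2))) (at t)"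
      unfolding has_real_derivative_iff_has_vector_derivative[symmetric]
      by simp
    have pos: "1 - (t * cmod \<xi>)\<^sup>2 > 0" using a by (simp add: abs_square_less_1)
    have "norm (\<phi>' t * deriv h (\<phi> t)) * (1 - (t * cmod \<xi>)\<^sup>2) =
        ((1 - (cmod (\<phi> t))\<^sup>2) * cmod (deriv h (\<phi> t))) * cmod \<xi>"
      using metric[of t] t by (simp add: norm_mult mult_ac)
    also have "\<dots> \<le> M * cmod \<xi>"
      using M[OF \<phi>_mem, of t] t by (intro mult_right_mono) auto
    finally show "norm (\<phi>' t * deriv h (\<phi> t)) \<le> M * (cmod \<xi> / (1 - (t * cmod \<xi>)\<^sup>2))"
      using pos by (simp add: pos_le_divide_eq)
  qed simp
  moreover have "cmod \<xi> = cmod ((z - w) / (1 - cnj z * w))"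
    by (simp add: \<xi>_def norm_divide norm_minus_commute)
  ultimately show ?thesis
    by (simp add: ends hyp_dist_def norm_minus_commute)
qed

lemma hyp_dist_pos:
  assumes "z \<in> unit_disk" "w \<in> unit_disk" "z \<noteq> w"
  shows "hyp_dist z w > 0"
proof -
  define x where "x = cmod ((z - w) / (1 - cnj z * w))"
  have "x < 1"
    using Moebius_function_norm_lt_1[of z w 0] assms
    by (simp add: x_def Moebius_function_simple norm_divide norm_minus_commute)
  moreover have "x > 0"
    using one_minus_cnj_mult_nonzero[of z w] assms by (simp add: x_def)
  ultimately have "1 < (1 + x) / (1 - x)" by simp
  then show ?thesis by (simp add: hyp_dist_def artanh_def flip: x_def)
qed

text \<open>The factor \<open>c\<close> turns \<open>b\<close> into the direction of
  \<open>a\<close>, which gives equality in the triangle inequality. Bounds for the single analytic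
  function \<open>h + c g\<close> thereby control sums of moduli.\<close>

lemma norm_add_unit_multiple:
  fixes a b :: complex
  obtains c where "cmod c = 1" "cmod (a + c * b) = cmod a + cmod b"
proof (cases "a = 0 \<or> b = 0")
  case True
  then show ?thesis using that[of 1] by auto
next
  case False
  let ?c = "a * of_real (cmod b) / (of_real (cmod a) * b)"
  have "a + ?c * b = a * of_real ((cmod a + cmod b) / cmod a)"
    using False by (simp add: field_simps)
  then have "cmod (a + ?c * b) = cmod a * ((cmod a + cmod b) / cmod a)"
    by (simp only: norm_mult norm_of_real) simp
  then have "cmod (a + ?c * b) = cmod a + cmod b"
    using False by simp
  moreover have "cmod ?c = 1" using False by (simp add: norm_divide norm_mult)
  ultimately show ?thesis by (rule that[rotated])
qed

lemma quasiregular_imp_harmonic_Bloch: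
  assumes qr: "quasiregular_harmonic K f"
    and h: "h holomorphic_on unit_disk" and g: "g holomorphic_on unit_disk"
    and f: "\<And>z. z \<in> unit_disk \<Longrightarrow> f z = h z + cnj (g z)"
    and C: "\<And>r. 0 < r \<Longrightarrow> r < 1 \<Longrightarrow> area_S f r \<le> C"
  shows "f \<in> harmonic_Bloch"
proof -
  define B where "B = sqrt (C * K)"
  have bound: "(1 - (cmod z)\<^sup>2) * (cmod (deriv h z) + cmod (deriv g z)) \<le> 2 * B"
    if z: "z \<in> unit_disk" for z
  proof -
    obtain c where c: "cmod c = 1" "cmod (deriv h z + c * deriv g z) = cmod (deriv h z) + cmod (deriv g z)"
      using norm_add_unit_multiple .
    have "(1 - cmod z) * (cmod (deriv h z) + cmod (deriv g z)) \<le> B"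
      using quasiregular_derivative_bound[OF qr h g f C, of c z] c z by (simp add: B_def)
    moreover have "0 \<le> (1 - cmod z) * (cmod (deriv h z) + cmod (deriv g z))" using z by simp
    \<comment> \<open>The factor 2 bounds \<open>1 + cmod z\<close> in the factorization of
      \<open>1 - (cmod z)\<^sup>2\<close>.\<close>
    ultimately have "(1 + cmod z) * ((1 - cmod z) * (cmod (deriv h z) + cmod (deriv g z))) \<le> 2 * B"
      using z by (intro mult_mono) auto
    then show ?thesis by (simp add: power2_eq_square algebra_simps)
  qed
  have sq: "0 \<le> 1 - (cmod z)\<^sup>2" if "z \<in> unit_disk" for z
    using that by (simp add: abs_square_le_1)
  have hB: "(1 - (cmod z)\<^sup>2) * cmod (deriv h z) \<le> 2 * B"
    and gB: "(1 - (cmod z)\<^sup>2) * cmod (deriv g z) \<le> 2 * B" if "z \<in> unit_disk" for z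
    using bound[OF that] mult_nonneg_nonneg[OF sq[OF that] norm_ge_zero[of "deriv h z"]]
      mult_nonneg_nonneg[OF sq[OF that] norm_ge_zero[of "deriv g z"]]
    unfolding distrib_left by linarith+
  \<comment> \<open>The analytic functions \<open>h\<close> and \<open>g\<close> contribute
    \<open>2 * B\<close> each.\<close>
  have "cmod (f z - f w) / hyp_dist z w \<le> 4 * B"
    if zw: "z \<in> unit_disk" "w \<in> unit_disk" "z \<noteq> w" for z w
  proof -
    have "f z - f w = (h z - h w) + cnj (g z - g w)"
      using f zw by simp
    then have "cmod (f z - f w) \<le> cmod (h z - h w) + cmod (g z - g w)"
      by (metis complex_mod_cnj norm_triangle_ineq)
    also have "\<dots> \<le> 2 * B * hyp_dist z w + 2 * B * hyp_dist z w"
      using Bloch_imp_hyperbolic_Lipschitz[OF h hB zw(1,2)] Bloch_imp_hyperbolic_Lipschitz[OF g gB zw(1,2)]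
      by simp
    finally show ?thesis
      using hyp_dist_pos[OF zw] by (simp add: pos_divide_le_eq)
  qed
  then have "bdd_above {cmod (f z - f w) / hyp_dist z w | z w. z \<in> unit_disk \<and> w \<in> unit_disk \<and> z \<noteq> w}"
    by (intro bdd_aboveI[of _ "4 * B"]) auto
  moreover have "harmonic_mapping f"
    using qr by (simp add: quasiregular_harmonic_def)
  ultimately show ?thesis by (simp add: harmonic_Bloch_def)
qed

section \<open>Coefficient estimates by Cauchy's inequality\<close>

text \<open>Cauchy's inequality for the \<open>n\<close>-th derivative of \<open>h' + c g'\<close>
  on the circle of radius \<rho>, where this function is at most
  \<open>sqrt (C * K) / (1 - \<rho>)\<close>. Differentiation shifts the index, so order
  \<open>n\<close> concerns the coefficients at \<open>Suc n\<close>. The radius stays free for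
  later optimization.\<close>

lemma quasiregular_coefficient_bound:
  assumes qr: "quasiregular_harmonic K f" and ex: "harmonic_expansion f h g a b"
    and C: "\<And>r. 0 < r \<Longrightarrow> r < 1 \<Longrightarrow> area_S f r \<le> C"
    and \<rho>: "0 < \<rho>" "\<rho> < 1"
  shows "real (Suc n) * (cmod (a (Suc n)) + cmod (b (Suc n))) * ((1 - \<rho>) * \<rho> ^ n) \<le> sqrt (C * K)"
proof -
  have h: "h holomorphic_on unit_disk" and g: "g holomorphic_on unit_disk"
    and f: "\<And>z. z \<in> unit_disk \<Longrightarrow> f z = h z + cnj (g z)"
    and hs: "\<And>z. z \<in> unit_disk \<Longrightarrow> (\<lambda>n. a (Suc n) * z ^ Suc n) sums h z"
    and gs: "\<And>z. z \<in> unit_disk \<Longrightarrow> (\<lambda>n. b (Suc n) * z ^ Suc n) sums g z"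
    using ex by (auto simp: harmonic_expansion_def)
  obtain c where c: "cmod c = 1"
    "cmod (a (Suc n) + c * b (Suc n)) = cmod (a (Suc n)) + cmod (b (Suc n))"
    using norm_add_unit_multiple .
  define F where "F z = h z + c * g z" for z
  define F' where "F' z = deriv h z + c * deriv g z" for z
  \<comment> \<open>The given series start at exponent 1, so the constant coefficient is set to 0
    whatever \<open>a 0\<close> and \<open>b 0\<close> are.\<close>
  have "F has_fps_expansion Abs_fps (\<lambda>k. if k = 0 then 0 else a k + c * b k)"
  proof (rule has_fps_expansionI, rule eventually_nhds_in_open[THEN eventually_mono])
    fix z assume z: "z \<in> unit_disk"
    have "(\<lambda>k. (a (Suc k) + c * b (Suc k)) * z ^ Suc k) sums F z"
      using sums_add[OF hs[OF z] sums_mult[OF gs[OF z], of c]]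
      by (simp add: F_def algebra_simps)
    then have "(\<lambda>k. fps_nth (Abs_fps (\<lambda>k. if k = 0 then 0 else a k + c * b k)) (Suc k) * z ^ Suc k) sums F z"
      by simp
    then show "(\<lambda>k. fps_nth (Abs_fps (\<lambda>k. if k = 0 then 0 else a k + c * b k)) k * z ^ k) sums F z"
      by (subst (asm) sums_Suc_iff) simp
  qed auto
  from fps_nth_fps_expansion[OF this, of "Suc n"]
  have F_coeff: "(deriv ^^ Suc n) F 0 = fact (Suc n) * (a (Suc n) + c * b (Suc n))"
    by (simp add: field_simps del: fact_Suc funpow.simps)
  have F': "deriv F z = F' z" if "z \<in> unit_disk" for z
    unfolding F_def[abs_def] F'_def
    by (intro DERIV_imp_deriv DERIV_add DERIV_cmult holomorphic_derivI[OF h open_ball that]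
        holomorphic_derivI[OF g open_ball that])
  have "F' holomorphic_on unit_disk"
    unfolding F'_def[abs_def]
    using holomorphic_deriv[OF h open_ball] holomorphic_deriv[OF g open_ball]
    by (intro holomorphic_on_add holomorphic_on_mult holomorphic_on_const)
  then have hol: "F' holomorphic_on ball 0 \<rho>" and cont: "continuous_on (cball 0 \<rho>) F'"
    using \<rho> by (auto intro!: holomorphic_on_imp_continuous_on elim!: holomorphic_on_subset)
  have "(deriv ^^ n) (deriv F) 0 = (deriv ^^ n) F' 0"
    by (intro higher_deriv_cong_ev eventually_nhds_in_open[of unit_disk, THEN eventually_mono])
      (use F' in auto)
  moreover have "(deriv ^^ Suc n) F 0 = (deriv ^^ n) (deriv F) 0"
    by (simp add: funpow_Suc_right del: funpow.simps)
  moreover have "cmod ((deriv ^^ n) F' 0) \<le> fact n * (sqrt (C * K) / (1 - \<rho>)) / \<rho> ^ n"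
  proof (rule Cauchy_inequality[OF hol cont \<rho>(1)])
    fix z :: complex assume "cmod (0 - z) = \<rho>"
    then show "cmod (F' z) \<le> sqrt (C * K) / (1 - \<rho>)"
      using quasiregular_derivative_bound[OF qr h g f C, of c z] c \<rho>
      by (simp add: F'_def pos_le_divide_eq mult.commute)
  qed
  ultimately have "cmod (fact (Suc n) * (a (Suc n) + c * b (Suc n))) \<le>
      fact n * (sqrt (C * K) / (1 - \<rho>)) / \<rho> ^ n"
    unfolding F_coeff by simp
  then have "fact (Suc n) * (cmod (a (Suc n)) + cmod (b (Suc n))) \<le>
      fact n * (sqrt (C * K) / (1 - \<rho>)) / \<rho> ^ n"
    unfolding norm_mult norm_fact c .
  then have "fact n * (real (Suc n) * (cmod (a (Suc n)) + cmod (b (Suc n))) * ((1 - \<rho>) * \<rho> ^ n)) \<le>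
      fact n * sqrt (C * K)"
    using \<rho> by (simp add: field_simps)
  then show ?thesis by simp
qed

section \<open>The identity map as extremal function\<close>

lemma area_S_id:
  assumes "0 < r" "r < 1"
  shows "area_S (\<lambda>z. z) r = r\<^sup>2"
proof -
  have "jacobian (\<lambda>z. z) z = 1" if "z \<in> ball 0 r" for z
  proof -
    have "z \<in> unit_disk" using that assms by simp
    from wirt_harmonic[of "\<lambda>z. z" "\<lambda>_. 0", OF _ _ _ this] show ?thesis
      by (simp add: jacobian_def holomorphic_on_ident)
  qed
  from area_S_eq_integral[OF assms _ this] show ?thesis
    using assms by (simp add: set_lebesgue_integral_def measure_ball_complex)
qed

lemma SUP_area_S_id:
  "bdd_above (area_S (\<lambda>z. z) ` {0<..<1})" "(SUP r\<in>{0<..<1}. area_S (\<lambda>z. z) r) = 1"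
proof -
  have img: "area_S (\<lambda>z. z) r \<le> 1" if "r \<in> {0<..<1}" for r
    using that by (simp add: area_S_id abs_square_le_1)
  then show bdd: "bdd_above (area_S (\<lambda>z. z) ` {0<..<1})"
    by (intro bdd_aboveI2)
  show "(SUP r\<in>{0<..<1}. area_S (\<lambda>z. z) r) = 1"
  proof (rule antisym)
    show "(SUP r\<in>{0<..<1}. area_S (\<lambda>z. z) r) \<le> 1"
      using img by (intro cSUP_least) auto
    show "1 \<le> (SUP r\<in>{0<..<1}. area_S (\<lambda>z. z) r)"
    \<comment> \<open>The value 1 is only approached: each \<open>x\<close> below 1 is the area at
      radius \<open>sqrt x\<close>.\<close>
    proof (rule field_le_mult_one_interval)
      fix x :: real assume x: "0 < x" "x < 1"
      then have "x * 1 = area_S (\<lambda>z. z) (sqrt x)"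
        by (subst area_S_id) auto
      also have "\<dots> \<le> (SUP r\<in>{0<..<1}. area_S (\<lambda>z. z) r)"
        using x by (intro cSUP_upper[OF _ bdd]) auto
      finally show "x * 1 \<le> (SUP r\<in>{0<..<1}. area_S (\<lambda>z. z) r)" .
    qed
  qed
qed

lemma quasiregular_harmonic_id: "quasiregular_harmonic 1 (\<lambda>z. z)"
proof -
  have "wirt_z (\<lambda>z. z) z = 1" "wirt_zbar (\<lambda>z. z) z = 0" if "z \<in> unit_disk" for z
    using wirt_harmonic[of "\<lambda>z. z" "\<lambda>_. 0", OF _ _ _ that] by (simp_all add: holomorphic_on_ident)
  moreover have "harmonic_mapping (\<lambda>z. z)"
    unfolding harmonic_mapping_def
    by (intro exI[of _ "\<lambda>z. z"] exI[of _ "\<lambda>_. 0"]) (simp add: holomorphic_on_ident)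
  ultimately show ?thesis
    by (simp add: quasiregular_harmonic_def sense_preserving_def Lambda_max_def lambda_min_def)
qed

lemma harmonic_expansion_id:
  "harmonic_expansion (\<lambda>z. z) (\<lambda>z. z) (\<lambda>z. 0) (\<lambda>n. if n = 1 then 1 else 0) (\<lambda>_. 0)"
  using sums_single[of 0 "\<lambda>n. z ^ Suc n" for z :: complex]
  by (simp add: harmonic_expansion_def holomorphic_on_ident if_distrib[of "\<lambda>x. x * _"] cong: if_cong)

theorem theorem2:
  "(\<forall>(K::real) (C::real) f h g a b.
      1 \<le> K \<longrightarrow> quasiregular_harmonic K f \<longrightarrow> harmonic_expansion f h g a b \<longrightarrow>
      bdd_above (area_S f ` {0<..<1}) \<longrightarrow> C = (SUP r\<in>{0<..<1}. area_S f r) \<longrightarrow>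
        f \<in> harmonic_Bloch \<and>
        cmod (a 1) + cmod (b 1) \<le> sqrt (C * K) \<and>
        (\<forall>n\<ge>2. cmod (a n) + cmod (b n)
                   \<le> 4 * sqrt (C * K) / pi * (1 + 1 / (real n - 1)) ^ (n - 1)))
   \<and> \<comment> \<open>sharpness for \<open>C = K = 1\<close>, attained by the identity map\<close>
   (quasiregular_harmonic 1 (\<lambda>z. z) \<and>
    bdd_above (area_S (\<lambda>z. z) ` {0<..<1}) \<and>
    (SUP r\<in>{0<..<1}. area_S (\<lambda>z. z) r) = 1 \<and>
    (\<exists>a b. harmonic_expansion (\<lambda>z. z) (\<lambda>z. z) (\<lambda>z. 0) a b \<and> cmod (a 1) = sqrt (1 * 1)))"
proof (rule conjI)
  show "\<forall>(K::real) (C::real) f h g a b.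
      1 \<le> K \<longrightarrow> quasiregular_harmonic K f \<longrightarrow> harmonic_expansion f h g a b \<longrightarrow>
      bdd_above (area_S f ` {0<..<1}) \<longrightarrow> C = (SUP r\<in>{0<..<1}. area_S f r) \<longrightarrow>
        f \<in> harmonic_Bloch \<and>
        cmod (a 1) + cmod (b 1) \<le> sqrt (C * K) \<and>
        (\<forall>n\<ge>2. cmod (a n) + cmod (b n)
                   \<le> 4 * sqrt (C * K) / pi * (1 + 1 / (real n - 1)) ^ (n - 1))"
  proof (intro allI impI)
    fix K C :: real and f h g a b
    assume qr: "quasiregular_harmonic K f" and ex: "harmonic_expansion f h g a b"
      and bdd: "bdd_above (area_S f ` {0<..<1})" and C_def: "C = (SUP r\<in>{0<..<1}. area_S f r)"
    have C: "area_S f r \<le> C" if "0 < r" "r < 1" for r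
      unfolding C_def using that by (intro cSUP_upper[OF _ bdd]) simp
    note coeff = quasiregular_coefficient_bound[OF qr ex C]
    \<comment> \<open>A coefficient estimate with its nonnegative left side settles the sign of the
      root.\<close>
    have s0: "0 \<le> sqrt (C * K)"
      by (rule order_trans[OF _ coeff[of "1 / 2" 0]]) simp_all
    have "f \<in> harmonic_Bloch"
      using ex by (intro quasiregular_imp_harmonic_Bloch[OF qr _ _ _ C, of h g])
        (auto simp: harmonic_expansion_def)
    moreover have "cmod (a 1) + cmod (b 1) \<le> sqrt (C * K)"
    \<comment> \<open>For the first coefficient the power of the radius is trivial, so the radius
      \<open>1 - x\<close> is sent to 0.\<close>
    proof (rule field_le_mult_one_interval)
      fix x :: real assume "0 < x" "x < 1"
      then show "x * (cmod (a 1) + cmod (b 1)) \<le> sqrt (C * K)"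
        using coeff[of "1 - x" 0] by (simp add: mult.commute)
    qed
    moreover have "cmod (a n) + cmod (b n) \<le> 4 * sqrt (C * K) / pi * (1 + 1 / (real n - 1)) ^ (n - 1)"
      if n: "n \<ge> 2" for n
    proof -
      define m where "m = n - 1"
      have m: "n = Suc m" "m > 0" using n by (auto simp: m_def)
      \<comment> \<open>The radius \<open>1 / q = m / (m + 1)\<close> maximizes
        \<open>(1 - \<rho>) * \<rho> ^ m\<close>. With this choice the factor
        \<open>1 - 1 / q\<close> cancels the index \<open>Suc m\<close> exactly.\<close>
      define q where "q = 1 + 1 / real m"
      have q: "q > 1" using m by (simp add: q_def)
      have i: "1 / q = real m / real (Suc m)" "real (Suc m) * (1 - 1 / q) = 1"
        using m by (simp_all add: q_def field_simps)
      have "(cmod (a n) + cmod (b n)) * (real (Suc m) * (1 - 1 / q)) * (1 / q) ^ m \<le> sqrt (C * K)"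
        using coeff[of "1 / q" m] q m by (simp add: mult_ac)
      then have "cmod (a n) + cmod (b n) \<le> sqrt (C * K) * q ^ m"
        unfolding i(2) using q by (simp add: power_one_over field_simps)
      \<comment> \<open>The stated constant is reached by weakening, since
        \<open>pi < 4\<close>.\<close>
      also have "\<dots> \<le> (4 / pi * sqrt (C * K)) * q ^ m"
      proof (rule mult_right_mono)
        show "sqrt (C * K) \<le> 4 / pi * sqrt (C * K)"
          using mult_right_mono[of 1 "4 / pi" "sqrt (C * K)"] s0 pi_less_4 by simp
      qed (use q in simp)
      finally show ?thesis using m by (simp add: q_def)
    qed
    ultimately show "f \<in> harmonic_Bloch \<and> cmod (a 1) + cmod (b 1) \<le> sqrt (C * K) \<and>
        (\<forall>n\<ge>2. cmod (a n) + cmod (b n)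
                   \<le> 4 * sqrt (C * K) / pi * (1 + 1 / (real n - 1)) ^ (n - 1))"
      by blast
  qed
next
  show "quasiregular_harmonic 1 (\<lambda>z. z) \<and>
    bdd_above (area_S (\<lambda>z. z) ` {0<..<1}) \<and>
    (SUP r\<in>{0<..<1}. area_S (\<lambda>z. z) r) = 1 \<and>
    (\<exists>a b. harmonic_expansion (\<lambda>z. z) (\<lambda>z. z) (\<lambda>z. 0) a b \<and> cmod (a 1) = sqrt (1 * 1))"
    by (intro conjI exI[of _ "\<lambda>n. if n = 1 then 1 else 0"] exI[of _ "\<lambda>_. 0"] quasiregular_harmonic_id SUP_area_S_id harmonic_expansion_id) simp
qed

end
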